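(* For every integer $t\ge 1$, there exist uncountably many $5$-point subsets $X\subset S^1$ with $1\in X$ and $\mathrm{Hst}(X)=\{t\}$. Moreover, no finite non-empty subset $X\subset S^1$ with fewer than $5$ points satisfies $\mathrm{Hst}(X)=\{t\}$.
   Context: Identify $S^1$ with $\{z\in\mathbb{C}: |z|=1\}\subset\mathbb{R}^2$. Here $\mathbb{N}=\{1,2,3,\dots\}$. For $d\ge 2$ and $k\in\mathbb{N}$, let $\mathrm{Harm}_k(d)$ denote the space of real homogeneous harmonic polynomials of degree $k$ in $d$ variables. For a non-empty finite set $X\subset S^{d-1}$ (a "spherical design"), its harmonic strength is $\mathrm{Hst}(X)=\{k\in\mathbb{N} : \sum_{\xi\in X}P(\xi)=0 \text{ for all } P\in\mathrm{Harm}_k(d)\}$. For $X\subset S^1$ this equals $\{k\in\mathbb{N}: \sum_{x\in X}x^k=0\}$, where $x^k$ is the complex power. *)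

theory Defs
  imports "HOL-Analysis.Analysis"
begin

(* R^d is an arbitrary Euclidean space 'a with d = DIM('a); coordinates are taken with respect
   to Basis.  For 'a = complex the basis is {1, \<i>}, so that the coordinates of z are Re z and
   Im z: this is the identification of the complex plane with R^2. *)

definition multi_indices :: "nat \<Rightarrow> ('a::euclidean_space \<Rightarrow> nat) set" where
  "multi_indices k = {\<alpha>. (\<forall>b. b \<notin> Basis \<longrightarrow> \<alpha> b = 0) \<and> (\<Sum>b\<in>Basis. \<alpha> b) = k}"

lemma finite_multi_indices: "finite (multi_indices k :: ('a::euclidean_space \<Rightarrow> nat) set)"
proof (rule finite_subset)
  show "multi_indices k \<subseteq> {f :: 'a \<Rightarrow> nat. \<forall>x. (x \<in> Basis \<longrightarrow> f x \<in> {..k}) \<and> (x \<notin> Basis \<longrightarrow> f x = 0)}"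
    by (auto simp: multi_indices_def intro: member_le_sum)
  show "finite {f :: 'a \<Rightarrow> nat. \<forall>x. (x \<in> Basis \<longrightarrow> f x \<in> {..k}) \<and> (x \<notin> Basis \<longrightarrow> f x = 0)}"
    by (rule finite_set_of_finite_funs) auto
qed

(* Real polynomials are represented by the functions they define; this loses nothing, since the
   field of real numbers is infinite. *)
definition homogeneous_poly :: "nat \<Rightarrow> ('a::euclidean_space \<Rightarrow> real) \<Rightarrow> bool" where
  "homogeneous_poly k P \<longleftrightarrow>
     (\<exists>c :: ('a \<Rightarrow> nat) \<Rightarrow> real.
        \<forall>x. P x = (\<Sum>\<alpha>\<in>multi_indices k. c \<alpha> * (\<Prod>b\<in>Basis. (x \<bullet> b) ^ \<alpha> b)))"

definition partial_deriv :: "'a::euclidean_space \<Rightarrow> ('a \<Rightarrow> real) \<Rightarrow> 'a \<Rightarrow> real" where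
  "partial_deriv b f x = deriv (\<lambda>s::real. f (x + s *\<^sub>R b)) 0"

definition laplacian :: "('a::euclidean_space \<Rightarrow> real) \<Rightarrow> 'a \<Rightarrow> real" where
  "laplacian f x = (\<Sum>b\<in>Basis. partial_deriv b (partial_deriv b f) x)"

definition Harm :: "nat \<Rightarrow> ('a::euclidean_space \<Rightarrow> real) set" where
  "Harm k = {P. homogeneous_poly k P \<and> (\<forall>x. laplacian P x = 0)}"

definition Hst :: "'a::euclidean_space set \<Rightarrow> nat set" where
  "Hst X = {k. 1 \<le> k \<and> (\<forall>P\<in>Harm k. (\<Sum>\<xi>\<in>X. P \<xi>) = 0)}"

end

theory Submission
  imports Defs "HOL-Complex_Analysis.Conformal_Mappings"
begin

text \<open>
  In the plane the harmonic polynomials of degree \<open>k \<ge> 1\<close> are the functions \<open>Re (c z\<^sup>k)\<close>, so the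
  harmonic strength of \<open>X\<close> is read off the power sums of \<open>X\<close>. If at most four unit numbers sum to
  zero then, by conjugation, their elementary symmetric functions vanish in complementary degrees,
  and Newton's identities make the sum of their squares or cubes vanish as well: \<open>t\<close> cannot be
  the only element of the strength.

  For five points take angles \<open>0\<close>, \<open>\<plusminus>\<alpha>/t\<close>, \<open>\<plusminus>\<beta>/t\<close> with \<open>\<alpha> = \<pi> + s\<close> and \<open>cos \<alpha> + cos \<beta> = -1/2\<close>. The
  \<open>k\<close>-th power sum is a holomorphic function of \<open>s\<close> near \<open>0\<close>. If it is constant, its derivative
  vanishes, which says \<open>sin (\<kappa> \<alpha>) sin \<beta> = sin (\<kappa> \<beta>) sin \<alpha>\<close> for \<open>\<kappa> = k/t\<close>. At \<open>s = 0\<close> (where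
  \<open>\<beta> = \<pi>/3\<close>) this forces \<open>\<kappa>\<close> to be an integer, and its derivative at \<open>s = 0\<close> gives
  \<open>\<kappa> \<cdot> (sqrt 3 / 2) = \<bar>sin (\<kappa> \<pi> / 3)\<bar> \<le> 1\<close>, hence \<open>\<kappa> = 1\<close>. So for each \<open>k \<noteq> t\<close> only countably
  many parameters \<open>s\<close> are bad.
\<close>

section \<open>Harmonic polynomials in the plane\<close>

text \<open>The basis is \<open>{1, \<i>}\<close>, so a multi-index of degree \<open>k\<close> is
  determined by its value \<open>j\<close> at \<open>1\<close>.\<close>

lemma homogeneous_poly_complex_iff:
  fixes P :: "complex \<Rightarrow> real"
  shows "homogeneous_poly k P \<longleftrightarrow> (\<exists>c. \<forall>z. P z = (\<Sum>j\<le>k. c j * Re z ^ j * Im z ^ (k - j)))"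
proof -
  define ix :: "nat \<Rightarrow> complex \<Rightarrow> nat"
    where "ix = (\<lambda>j b. if b = 1 then j else if b = \<i> then k - j else 0)"
  have bij: "bij_betw ix {..k} (multi_indices k)"
  proof (rule bij_betw_byWitness[where f' = "\<lambda>\<alpha>. \<alpha> 1"])
    show "\<forall>\<alpha>\<in>multi_indices k. ix (\<alpha> 1) = \<alpha>"
      by (auto simp: multi_indices_def ix_def Basis_complex_def fun_eq_iff)
  qed (auto simp: multi_indices_def ix_def Basis_complex_def)
  have eq: "(\<Sum>\<alpha>\<in>multi_indices k. c \<alpha> * (\<Prod>b\<in>Basis. (z \<bullet> b) ^ \<alpha> b))
      = (\<Sum>j\<le>k. c (ix j) * Re z ^ j * Im z ^ (k - j))"
    for c :: "(complex \<Rightarrow> nat) \<Rightarrow> real" and z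
    by (subst sum.reindex_bij_betw[OF bij, symmetric])
      (simp add: Basis_complex_def ix_def mult.assoc)
  show ?thesis
  proof
    assume "homogeneous_poly k P"
    then show "\<exists>c. \<forall>z. P z = (\<Sum>j\<le>k. c j * Re z ^ j * Im z ^ (k - j))"
      unfolding homogeneous_poly_def eq by (elim exE) (rule exI, assumption)
  next
    assume "\<exists>c. \<forall>z. P z = (\<Sum>j\<le>k. c j * Re z ^ j * Im z ^ (k - j))"
    then obtain c where c: "\<And>z. P z = (\<Sum>j\<le>k. c j * Re z ^ j * Im z ^ (k - j))" by blast
    show "homogeneous_poly k P"
      unfolding homogeneous_poly_def eq
      by (rule exI[where x = "\<lambda>\<alpha>. c (\<alpha> 1)"]) (simp add: c ix_def)
  qed
qed

text \<open>With arbitrary exponents the result has the shape of the input, so the rule can be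
  applied twice. Truncation in \<open>m j - 1\<close> is harmless: the factor \<open>m j\<close> is
  then 0.\<close>

lemma partial_deriv_1_sum:
  "partial_deriv 1 (\<lambda>z. \<Sum>j\<in>J. c j * Re z ^ m j * Im z ^ n j)
    = (\<lambda>z. \<Sum>j\<in>J. (c j * m j) * Re z ^ (m j - 1) * Im z ^ n j)"
  unfolding partial_deriv_def
  by (rule ext, rule DERIV_imp_deriv)
    (auto intro!: derivative_eq_intros simp: mult_ac)

lemma partial_deriv_i_sum:
  "partial_deriv \<i> (\<lambda>z. \<Sum>j\<in>J. c j * Re z ^ m j * Im z ^ n j)
    = (\<lambda>z. \<Sum>j\<in>J. (c j * n j) * Re z ^ m j * Im z ^ (n j - 1))"
  unfolding partial_deriv_def
  by (rule ext, rule DERIV_imp_deriv)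
    (auto intro!: derivative_eq_intros simp: mult_ac)

lemma laplacian_sum:
  "laplacian (\<lambda>z. \<Sum>j\<in>J. c j * Re z ^ m j * Im z ^ n j) z
    = (\<Sum>j\<in>J. c j * m j * (m j - 1 :: nat) * Re z ^ (m j - 1 - 1) * Im z ^ n j)
    + (\<Sum>j\<in>J. c j * n j * (n j - 1 :: nat) * Re z ^ m j * Im z ^ (n j - 1 - 1))"
  unfolding laplacian_def
  by (simp add: Basis_complex_def partial_deriv_1_sum partial_deriv_i_sum)

text \<open>On the line \<open>Im z = 1\<close> the Laplacian is a polynomial in \<open>Re z\<close>
  that vanishes identically, and its coefficients are the left-hand sides.\<close>

lemma harmonic_coeff_recurrence:
  assumes lap: "\<And>z. laplacian (\<lambda>z. \<Sum>j\<le>n+2. c j * Re z ^ j * Im z ^ (n + 2 - j)) z = 0"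
    and "j \<le> n"
  shows "c (j + 2) * (real j + 2) * (real j + 1) + c j * (real n + 2 - j) * (real n + 1 - j) = 0"
proof -
  define d where "d j = c (j + 2) * (real j + 2) * (real j + 1)
    + c j * (real n + 2 - real j) * (real n + 1 - real j)" for j
  have "(\<Sum>j\<le>n. d j * x ^ j) = 0" for x
  proof -
    have "0 = laplacian (\<lambda>z. \<Sum>j\<le>n+2. c j * Re z ^ j * Im z ^ (n + 2 - j)) (Complex x 1)"
      by (rule lap[symmetric])
    also have "\<dots> = (\<Sum>j\<le>n+2. c j * j * (j - 1 :: nat) * x ^ (j - 1 - 1))
      + (\<Sum>j\<le>n+2. c j * (n + 2 - j :: nat) * (n + 2 - j - 1 :: nat) * x ^ j)"
      by (simp only: laplacian_sum complex.sel power_one mult_1_right)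
    \<comment> \<open>The terms 0 and 1 vanish here, and the two top terms vanish in the other
      sum.\<close>
    also have "(\<Sum>j\<le>n+2. c j * j * (j - 1 :: nat) * x ^ (j - 1 - 1))
      = (\<Sum>j\<le>n. c (j + 2) * (real j + 2) * (real j + 1) * x ^ j)"
      by (simp del: sum.atMost_Suc add: sum.atMost_Suc_shift add_ac)
    also have "(\<Sum>j\<le>n+2. c j * (n + 2 - j :: nat) * (n + 2 - j - 1 :: nat) * x ^ j)
      = (\<Sum>j\<le>n. c j * (real n + 2 - j) * (real n + 1 - j) * x ^ j)"
      by (simp, intro sum.cong) (auto simp: of_nat_diff Suc_diff_le algebra_simps)
    finally show ?thesis
      by (simp only: d_def sum.distrib distrib_right)
  qed
  then have "d j = 0"
    using \<open>j \<le> n\<close> by (rule zero_polynom_imp_zero_coeffs)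
  then show ?thesis by (simp add: d_def)
qed

text \<open>The recurrence yields \<open>c j\<close> from \<open>c (j + 2)\<close>, so zeros
  propagate downwards from the two top coefficients.\<close>

lemma harmonic_coeffs_eq_0:
  assumes lap: "\<And>z. laplacian (\<lambda>z. \<Sum>j\<le>k. c j * Re z ^ j * Im z ^ (k - j)) z = 0"
    and top: "c k = 0" "c (k - 1) = 0" and "j \<le> k"
  shows "c j = 0"
  using \<open>j \<le> k\<close>
proof (induction "k - j" arbitrary: j rule: less_induct)
  case less
  show ?case
  proof (cases "j + 2 \<le> k")
    case True
    then obtain n where n: "k = n + 2" "j \<le> n"
      by (metis add_le_cancel_right le_add_diff_inverse2 add_leD2)
    have "c (j + 2) = 0"
      using less.hyps[of "j + 2"] True by simp
    with harmonic_coeff_recurrence[of c n j] lap n have "c j * (real n + 2 - j) * (real n + 1 - j) = 0"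
      by simp
    then show ?thesis using n by auto
  next
    case False
    then have "j = k \<or> j = k - 1" using less.prems by linarith
    then show ?thesis using top by auto
  qed
qed

lemma partial_deriv_Re_mult_power:
  "partial_deriv b (\<lambda>z. Re (c * z ^ n)) = (\<lambda>z. Re (b * c * of_nat n * z ^ (n - 1)))"
proof
  fix z :: complex
  have "((\<lambda>s. c * (z + s *\<^sub>R b) ^ n) has_vector_derivative b * c * of_nat n * z ^ (n - 1)) (at (0::real))"
    unfolding has_vector_derivative_def
    by (auto intro!: derivative_eq_intros simp: scaleR_conv_of_real mult_ac fun_eq_iff)
  then have "((\<lambda>s. Re (c * (z + s *\<^sub>R b) ^ n)) has_vector_derivative Re (b * c * of_nat n * z ^ (n - 1))) (at (0::real))"
    by (rule bounded_linear.has_vector_derivative[OF bounded_linear_Re])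
  then show "partial_deriv b (\<lambda>z. Re (c * z ^ n)) z = Re (b * c * of_nat n * z ^ (n - 1))"
    unfolding partial_deriv_def
    by (intro DERIV_imp_deriv) (simp add: has_real_derivative_iff_has_vector_derivative)
qed

text \<open>Each derivative along \<open>b\<close> multiplies the coefficient by \<open>b\<close>;
  the two second derivatives carry the factors \<open>1\<close> and \<open>\<i> * \<i>\<close> and
  cancel.\<close>

lemma laplacian_Re_mult_power: "laplacian (\<lambda>z. Re (c * z ^ n)) z = 0"
proof -
  have "laplacian (\<lambda>z. Re (c * z ^ n)) z
      = Re (1 * (1 * c * of_nat n) * of_nat (n - 1) * z ^ (n - 1 - 1))
      + Re (\<i> * (\<i> * c * of_nat n) * of_nat (n - 1) * z ^ (n - 1 - 1))"
    unfolding laplacian_def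
    by (simp only: Basis_complex_def partial_deriv_Re_mult_power) simp
  also have "\<dots> = Re ((1 + \<i> * \<i>) * (c * of_nat n * of_nat (n - 1) * z ^ (n - 1 - 1)))"
    by (simp only: plus_complex.sel(1)[symmetric]) (simp only: ring_distribs mult.assoc mult_1_left)
  finally show ?thesis by simp
qed

lemma Re_complex_of_real_mult: "Re (of_real r * z) = r * Re z"
  by simp

lemma Re_mult_power_expand:
  "Re (c * z ^ k) = (\<Sum>j\<le>k. (of_nat (k choose j) * Re (c * \<i> ^ (k - j))) * Re z ^ j * Im z ^ (k - j))"
proof -
  have "c * z ^ k = c * (of_real (Re z) + \<i> * of_real (Im z)) ^ k"
    by (simp flip: complex_eq)
  also have "\<dots> = (\<Sum>j\<le>k. of_real (of_nat (k choose j) * Re z ^ j * Im z ^ (k - j)) * (c * \<i> ^ (k - j)))"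
    by (subst binomial_ring) (simp add: sum_distrib_left power_mult_distrib mult_ac)
  finally have "Re (c * z ^ k) = (\<Sum>j\<le>k. Re (of_real (of_nat (k choose j) * Re z ^ j * Im z ^ (k - j)) * (c * \<i> ^ (k - j))))"
    by (simp only: Re_sum)
  then show ?thesis
    by (simp only: Re_complex_of_real_mult) (simp only: mult_ac)
qed

lemma Re_mult_power_in_Harm: "(\<lambda>z. Re (c * z ^ k)) \<in> Harm k"
proof -
  have "\<exists>p. \<forall>z. Re (c * z ^ k) = (\<Sum>j\<le>k. p j * Re z ^ j * Im z ^ (k - j))"
    by (intro exI allI) (rule Re_mult_power_expand)
  then show ?thesis
    unfolding Harm_def homogeneous_poly_complex_iff by (simp only: mem_Collect_eq laplacian_Re_mult_power simp_thms)
qed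

lemma Harm_complexE:
  fixes P :: "complex \<Rightarrow> real"
  assumes P: "P \<in> Harm k" and "k \<ge> 1"
  obtains c where "P = (\<lambda>z. Re (c * z ^ k))"
proof -
  obtain p where p: "\<And>z. P z = (\<Sum>j\<le>k. p j * Re z ^ j * Im z ^ (k - j))"
    using P by (auto simp: Harm_def homogeneous_poly_complex_iff)
  have lapP: "laplacian P z = 0" for z
    using P by (simp add: Harm_def)
  \<comment> \<open>In \<open>Re (c * z ^ k)\<close> the two top coefficients are
    \<open>Re c\<close> and \<open>- k * Im c\<close>. This \<open>c\<close> matches them to those
    of \<open>P\<close>, and the harmonic difference then vanishes.\<close>
  define c where "c = Complex (p k) (- p (k - 1) / k)"
  define q where "q j = of_nat (k choose j) * Re (c * \<i> ^ (k - j))" for j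
  have q: "Re (c * z ^ k) = (\<Sum>j\<le>k. q j * Re z ^ j * Im z ^ (k - j))" for z
    unfolding q_def by (rule Re_mult_power_expand)
  have "laplacian (\<lambda>z. \<Sum>j\<le>k. (p j - q j) * Re z ^ j * Im z ^ (k - j)) z
      = laplacian P z - laplacian (\<lambda>z. Re (c * z ^ k)) z" for z
    unfolding ext[of P, OF p] ext[OF q] laplacian_sum
    by (simp add: sum_subtractf left_diff_distrib)
  then have "laplacian (\<lambda>z. \<Sum>j\<le>k. (p j - q j) * Re z ^ j * Im z ^ (k - j)) z = 0" for z
    by (simp only: lapP laplacian_Re_mult_power)
  moreover have "p k - q k = 0" by (simp add: q_def c_def)
  moreover have "p (k - 1) - q (k - 1) = 0"
    using \<open>k \<ge> 1\<close> binomial_symmetric[of "k-1" k] by (simp add: q_def c_def)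
  ultimately have "p j = q j" if "j \<le> k" for j
    using harmonic_coeffs_eq_0[of "\<lambda>j. p j - q j" k j] that by simp
  then have "P = (\<lambda>z. Re (c * z ^ k))"
    unfolding fun_eq_iff p q by simp
  then show ?thesis by (rule that)
qed

lemma Hst_complex:
  fixes X :: "complex set"
  shows "Hst X = {k. 1 \<le> k \<and> (\<Sum>x\<in>X. x ^ k) = 0}"
proof (intro set_eqI iffI)
  fix k assume "k \<in> Hst X"
  then have k: "1 \<le> k" and *: "(\<Sum>x\<in>X. Re (c * x ^ k)) = 0" for c
    using Re_mult_power_in_Harm by (auto simp: Hst_def)
  \<comment> \<open>The choices \<open>c = 1\<close> and \<open>c = - \<i>\<close> extract the real
    and imaginary parts.\<close>
  have "Re (\<Sum>x\<in>X. x ^ k) = 0" "Im (\<Sum>x\<in>X. x ^ k) = 0"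
    using *[of 1] *[of "- \<i>"] by simp_all
  with k show "k \<in> {k. 1 \<le> k \<and> (\<Sum>x\<in>X. x ^ k) = 0}"
    by (simp add: complex_eq_iff)
next
  fix k assume "k \<in> {k. 1 \<le> k \<and> (\<Sum>x\<in>X. x ^ k) = 0}"
  then have k: "1 \<le> k" and 0: "(\<Sum>x\<in>X. x ^ k) = 0" by auto
  have "(\<Sum>x\<in>X. P x) = 0" if "P \<in> Harm k" for P
  proof -
    obtain c where "P = (\<lambda>z. Re (c * z ^ k))"
      using Harm_complexE[OF \<open>P \<in> Harm k\<close> k] .
    then have "(\<Sum>x\<in>X. P x) = Re (c * (\<Sum>x\<in>X. x ^ k))"
      by (simp only: sum_distrib_left Re_sum)
    then show ?thesis by (simp add: 0)
  qed
  with k show "k \<in> Hst X" by (simp add: Hst_def)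
qed

section \<open>Power sums of at most four unit numbers\<close>

text \<open>As \<open>cnj\<close> inverts unit numbers, the conjugate relation times
  \<open>a * b * c\<close> is e2 = 0, and p2 = e1^2 - 2 e2.\<close>

lemma sum_power2_eq_0_of_3:
  fixes a b c :: complex
  assumes norm: "norm a = 1" "norm b = 1" "norm c = 1" and sum: "a + b + c = 0"
  shows "a\<^sup>2 + b\<^sup>2 + c\<^sup>2 = 0"
proof -
  have inv: "a * cnj a = 1" "b * cnj b = 1" "c * cnj c = 1"
    using norm by (simp_all add: complex_norm_square[symmetric])
  have cnj: "cnj a + cnj b + cnj c = 0"
    using arg_cong[OF sum, of cnj] by simp
  have "b * c + a * c + a * b = 0"
    using inv cnj by algebra
  then show ?thesis using sum by algebra
qed

text \<open>Conjugation now gives e3 = 0, and p3 = e1^3 - 3 e1 e2 + 3 e3; e2 may be nonzero.\<close>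

lemma sum_power3_eq_0_of_4:
  fixes a b c d :: complex
  assumes norm: "norm a = 1" "norm b = 1" "norm c = 1" "norm d = 1" and sum: "a + b + c + d = 0"
  shows "a ^ 3 + b ^ 3 + c ^ 3 + d ^ 3 = 0"
proof -
  have inv: "a * cnj a = 1" "b * cnj b = 1" "c * cnj c = 1" "d * cnj d = 1"
    using norm by (simp_all add: complex_norm_square[symmetric])
  have cnj: "cnj a + cnj b + cnj c + cnj d = 0"
    using arg_cong[OF sum, of cnj] by simp
  have "b * c * d + a * c * d + a * b * d + a * b * c = 0"
    using inv cnj by algebra
  then show ?thesis using sum by algebra
qed

text \<open>The previous two lemmas are applied to the \<open>t\<close>-th powers, which may
  coincide even though the points are distinct. One point cannot have sum 0, and two opposite powers
  have opposite cubes.\<close>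

lemma power_sum_eq_0_of_card_less_5:
  fixes X :: "complex set"
  assumes "finite X" "X \<noteq> {}" "X \<subseteq> sphere 0 1" "card X < 5" and sum: "(\<Sum>x\<in>X. x ^ t) = 0"
  shows "(\<Sum>x\<in>X. x ^ (2 * t)) = 0 \<or> (\<Sum>x\<in>X. x ^ (3 * t)) = 0"
proof -
  have pow: "x ^ (2 * t) = (x ^ t)\<^sup>2" "x ^ (3 * t) = (x ^ t) ^ 3" for x :: complex
    by (simp_all add: power_mult[symmetric] mult.commute)
  have norm: "norm (x ^ t) = 1" if "x \<in> X" for x
    using that \<open>X \<subseteq> sphere 0 1\<close> by (auto simp: norm_power)
  have "card X \<noteq> 0" using assms by simp
  with \<open>card X < 5\<close> consider "card X = 1" | "card X = 2" | "card X = 3" | "card X = 4"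
    by linarith
  then show ?thesis
  proof cases
    case 1
    then obtain a where X: "X = {a}" by (auto simp: card_1_singleton_iff)
    show ?thesis using sum norm[of a] by (simp add: X)
  next
    case 2
    then obtain a b where X: "X = {a, b}" "a \<noteq> b" by (auto simp: card_2_iff)
    then have "a ^ t + b ^ t = 0" using sum by simp
    then have "b ^ t = - (a ^ t)" by (simp add: add_eq_0_iff)
    then have "(a ^ t) ^ 3 + (b ^ t) ^ 3 = 0" by simp
    then show ?thesis using X by (simp add: pow)
  next
    case 3
    then obtain a b c where X: "X = {a, b, c}" "a \<noteq> b" "b \<noteq> c" "a \<noteq> c" by (auto simp: card_3_iff)
    then have "a ^ t + b ^ t + c ^ t = 0" using sum by (simp add: add_ac)
    then have "(a ^ t)\<^sup>2 + (b ^ t)\<^sup>2 + (c ^ t)\<^sup>2 = 0"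
      using norm X by (intro sum_power2_eq_0_of_3) auto
    then show ?thesis using X by (simp add: pow add_ac)
  next
    case 4
    then obtain d Y where "X = insert d Y" "d \<notin> Y" "card Y = 3"
      by (metis card_Suc_eq eval_nat_numeral(2) semiring_norm(26,27) numeral_eq_Suc pred_numeral_simps(2))
    then obtain a b c where X: "X = {d, a, b, c}" "a \<noteq> b" "b \<noteq> c" "a \<noteq> c" "d \<noteq> a" "d \<noteq> b" "d \<noteq> c"
      by (auto simp: card_3_iff)
    then have "a ^ t + b ^ t + c ^ t + d ^ t = 0" using sum by (simp add: add_ac)
    then have "(a ^ t) ^ 3 + (b ^ t) ^ 3 + (c ^ t) ^ 3 + (d ^ t) ^ 3 = 0"
      using norm X by (intro sum_power3_eq_0_of_4) auto
    then show ?thesis using X by (simp add: pow add_ac)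
  qed
qed

section \<open>The power sum as a holomorphic function of the parameter\<close>

text \<open>
  Here \<open>\<kappa> = k/t\<close>; the second angle is \<open>Arccos (cos z - 1/2)\<close> because \<open>cos (\<pi> + z) = - cos z\<close>.
\<close>
definition power_sum_fun :: "real \<Rightarrow> complex \<Rightarrow> complex" where
  "power_sum_fun \<kappa> z = 1 + 2 * cos (of_real \<kappa> * (of_real pi + z))
     + 2 * cos (of_real \<kappa> * Arccos (cos z - 1 / 2))"

lemma Arccos_half: "Arccos (1 / 2) = of_real (pi / 3)"
proof -
  have "arccos (1 / 2) = pi / 3"
    using arccos_cos[of "pi / 3"] by (simp add: cos_60)
  then show ?thesis
    using of_real_arccos[of "1 / 2"] by simp
qed

text \<open>The disc meets the real axis in the interval from 0 to 1, away from the cuts of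
  \<open>Arccos\<close> and from its branch points 1 and -1.\<close>

lemma ball_half_avoids_cuts: "z \<in> ball (1 / 2 :: complex) (1 / 2) \<Longrightarrow> Im z = 0 \<Longrightarrow> \<bar>Re z\<bar> < 1"
  using abs_Re_le_cmod[of "z - 1/2"] by (auto simp: dist_norm norm_minus_commute)

lemma has_field_derivative_Arccos_cos:
  assumes "cos z - 1 / 2 \<in> ball (1 / 2) (1 / 2)"
  shows "((\<lambda>z. Arccos (cos z - 1 / 2)) has_field_derivative sin z / sin (Arccos (cos z - 1 / 2))) (at z)"
proof -
  have inner: "((\<lambda>z. cos z - 1 / 2) has_field_derivative - sin z) (at z)"
    by (rule derivative_eq_intros refl)+ simp
  have "(Arccos has_field_derivative - inverse (sin (Arccos (cos z - 1 / 2)))) (at (cos z - 1 / 2))"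
    by (rule has_field_derivative_Arccos) (rule ball_half_avoids_cuts[OF assms])
  from DERIV_chain2[where f = Arccos and g = "\<lambda>z. cos z - 1 / 2", OF this inner]
  show ?thesis by (simp only: minus_mult_minus divide_inverse mult.commute)
qed

lemma has_field_derivative_power_sum_fun:
  assumes "cos z - 1 / 2 \<in> ball (1 / 2) (1 / 2)"
  defines "w \<equiv> Arccos (cos z - 1 / 2)"
  shows "(power_sum_fun \<kappa> has_field_derivative
    - (2 * \<kappa>) * (sin (of_real \<kappa> * (of_real pi + z)) + sin (of_real \<kappa> * w) * (sin z / sin w))) (at z)"
  unfolding power_sum_fun_def[abs_def] w_def
  by (rule derivative_eq_intros has_field_derivative_Arccos_cos[OF assms(1)] refl)+
    (simp add: algebra_simps)

lemma sin_Arccos_nonzero_ball: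
  assumes "u \<in> ball (1 / 2) (1 / 2)"
  shows "sin (Arccos u) \<noteq> 0"
proof (rule sin_Arccos_nonzero)
  show "u\<^sup>2 \<noteq> 1"
    using ball_half_avoids_cuts[OF assms] by (auto simp: power2_eq_1_iff)
qed

lemma power_sum_fun_not_constant:
  assumes U: "open U" "0 \<in> U" "\<And>z. z \<in> U \<Longrightarrow> cos z - 1 / 2 \<in> ball (1 / 2) (1 / 2)"
    and \<kappa>: "\<kappa> > 0" "\<kappa> \<noteq> 1"
  shows "\<not> power_sum_fun \<kappa> constant_on U"
proof
  assume "power_sum_fun \<kappa> constant_on U"
  then obtain C where C: "\<And>z. z \<in> U \<Longrightarrow> power_sum_fun \<kappa> z = C"
    by (auto simp: constant_on_def)
  define B where "B z = Arccos (cos z - 1 / 2)" for z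
  have B0: "B 0 = of_real (pi / 3)" by (simp add: B_def Arccos_half[simplified])
  \<comment> \<open>The derivative of \<open>power_sum_fun\<close>, up to the constant factor
    \<open>- 2 * \<kappa>\<close>, with the denominator \<open>sin (B z)\<close> cleared.\<close>
  define g where "g z = sin (of_real \<kappa> * (of_real pi + z)) * sin (B z) + sin (of_real \<kappa> * B z) * sin z" for z
  have g: "g z = 0" if "z \<in> U" for z
  proof -
    have "(power_sum_fun \<kappa> has_field_derivative 0) (at z)"
      by (rule has_field_derivative_transform_within_open[OF DERIV_const[of C] \<open>open U\<close> that])
        (simp add: C)
    from DERIV_unique[OF this has_field_derivative_power_sum_fun[OF U(3)[OF that]]]
    have "sin (of_real \<kappa> * (of_real pi + z)) + sin (of_real \<kappa> * B z) * (sin z / sin (B z)) = 0"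
      using \<kappa> by (simp add: B_def)
    moreover have "sin (B z) \<noteq> 0"
      using sin_Arccos_nonzero_ball[OF U(3)[OF that]] by (simp add: B_def)
    ultimately show ?thesis by (simp add: g_def field_simps)
  qed
  have "sin (B 0) = of_real (sqrt 3 / 2)"
    by (simp only: B0 sin_of_real sin_60)
  with g[OF U(2)] have "of_real (sin (\<kappa> * pi)) * of_real (sqrt 3 / 2) = (0::complex)"
    by (simp add: g_def sin_of_real[symmetric])
  then have sin0: "sin (\<kappa> * pi) = 0"
    by (simp flip: of_real_mult)
  \<comment> \<open>Since \<open>cos\<close> is stationary at 0, so is \<open>B\<close>; only the
    explicit occurrences of \<open>z\<close> in \<open>g\<close> contribute to its derivative
    there.\<close>
  have dB: "(B has_field_derivative 0) (at 0)"
    using has_field_derivative_Arccos_cos[OF U(3)[OF U(2)]] by (simp add: B_def[abs_def])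
  have "(g has_field_derivative 0) (at 0)"
    by (rule has_field_derivative_transform_within_open[OF DERIV_const[of 0] \<open>open U\<close> \<open>0 \<in> U\<close>])
      (simp add: g)
  moreover have "(g has_field_derivative
      of_real \<kappa> * cos (of_real \<kappa> * of_real pi) * sin (B 0) + sin (of_real \<kappa> * B 0)) (at 0)"
    unfolding g_def[abs_def]
    by (rule derivative_eq_intros dB refl)+ simp
  ultimately have "of_real \<kappa> * cos (of_real \<kappa> * of_real pi) * sin (B 0) + sin (of_real \<kappa> * B 0) = 0"
    using DERIV_unique by blast
  then have "complex_of_real (\<kappa> * cos (\<kappa> * pi) * (sqrt 3 / 2) + sin (\<kappa> * (pi / 3))) = 0"
    by (simp only: B0 sin_of_real cos_of_real sin_60 flip: of_real_mult of_real_add)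
  then have eq: "\<kappa> * cos (\<kappa> * pi) * (sqrt 3 / 2) = - sin (\<kappa> * (pi / 3))"
    by (simp only: of_real_eq_0_iff)
  have "\<bar>cos (\<kappa> * pi)\<bar> = 1"
    using sin0 sin_zero_abs_cos_one by blast
  then have "\<kappa> * (sqrt 3 / 2) = \<bar>sin (\<kappa> * (pi / 3))\<bar>"
    using arg_cong[OF eq, of abs] \<kappa> by (simp add: abs_mult)
  then have "\<kappa> * (sqrt 3 / 2) \<le> 1" by simp
  moreover have "2 \<le> \<kappa>"
  proof -
    obtain i :: int where "\<kappa> * pi = of_int i * pi"
      using sin0 by (auto simp: sin_zero_iff_int2)
    then have "\<kappa> = of_int i" by simp
    with \<kappa> show ?thesis by auto
  qed
  then have "2 * (sqrt 3 / 2) \<le> \<kappa> * (sqrt 3 / 2)"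
    by (intro mult_right_mono) auto
  moreover have "sqrt 3 > (1::real)" by simp
  ultimately show False by linarith
qed

section \<open>The five-point sets\<close>

text \<open>Division by \<open>t\<close> keeps the angles strictly between \<open>- pi\<close> and
  \<open>pi\<close>, so \<open>Arg\<close> recovers them and the points are distinct. By symmetry
  the sines cancel in the sum.\<close>

lemma sum_cis_five_points:
  fixes t :: nat and a b :: real
  defines "A \<equiv> {0, a, - a, b, - b}"
  defines "X \<equiv> (\<lambda>x. cis (x / t)) ` A"
  assumes t: "t \<ge> 1" and ab: "0 < a" "a < pi" "0 < b" "b < pi" "a \<noteq> b"
  shows "card X = 5"
    and "(\<Sum>x\<in>X. x ^ k) = of_real (1 + 2 * cos (k / t * a) + 2 * cos (k / t * b))"
proof -
  have bound: "\<bar>x / t\<bar> < pi" if "x \<in> A" for x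
  proof -
    have "\<bar>x / t\<bar> \<le> \<bar>x\<bar>"
      using t by (simp add: abs_divide divide_le_eq mult_le_cancel_left1)
    also have "\<bar>x\<bar> < pi"
      using that ab by (auto simp: A_def)
    finally show ?thesis .
  qed
  have "Arg (cis (x / t)) = x / t" if "x \<in> A" for x
  proof (rule cis_Arg_unique)
    show "- pi < x / t" "x / t \<le> pi" using bound[OF that] by linarith+
  qed (simp add: sgn_eq)
  then have inj: "inj_on (\<lambda>x. cis (x / t)) A"
    using t by (intro inj_onI) (metis divide_cancel_right of_nat_0_eq_iff not_one_le_zero)
  have "card A = 5"
    using ab by (simp add: A_def)
  then show "card X = 5"
    using inj by (simp add: X_def card_image)
  have "(\<Sum>x\<in>X. x ^ k) = (\<Sum>x\<in>A. cis (k / t * x))"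
    unfolding X_def by (subst sum.reindex[OF inj]) (simp add: Complex.DeMoivre mult.commute)
  also have "\<dots> = of_real (1 + 2 * cos (k / t * a) + 2 * cos (k / t * b))"
    using ab by (simp add: A_def complex_eq_iff)
  finally show "(\<Sum>x\<in>X. x ^ k) = of_real (1 + 2 * cos (k / t * a) + 2 * cos (k / t * b))" .
qed

definition five_points :: "nat \<Rightarrow> real \<Rightarrow> complex set" where
  "five_points t s = (let a = pi + s; b = arccos (cos s - 1 / 2)
     in (\<lambda>x. cis (x / t)) ` {0, a, - a, b, - b})"

lemma five_points:
  assumes "t \<ge> 1" "- pi < s" "s < 0" "cos s > 1 / 2"
  shows "card (five_points t s) = 5"
    and "(\<Sum>x\<in>five_points t s. x ^ k) = power_sum_fun (k / t) (of_real s)"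
proof -
  define b where "b = arccos (cos s - 1 / 2)"
  have "cos s < 1"
    using cos_monotone_minus_pi_0[of s 0] assms by simp
  then have b: "0 < b" "b < pi" and cos_b: "cos b = cos s - 1 / 2"
    using \<open>cos s > 1 / 2\<close> arccos_lt_bounded[of "cos s - 1 / 2"] by (auto simp: b_def)
  \<comment> \<open>The cosines have opposite signs: \<open>cos (pi + s) = - cos s\<close> is
    negative, \<open>cos b\<close> is positive.\<close>
  have "pi + s \<noteq> b"
  proof
    assume "pi + s = b"
    then have "cos b = - cos s" by (auto simp: cos_add)
    then show False using cos_b \<open>cos s > 1 / 2\<close> by simp
  qed
  note five = sum_cis_five_points[OF \<open>t \<ge> 1\<close> _ _ b this]
  show "card (five_points t s) = 5"
    using five(1) assms unfolding five_points_def b_def Let_def by linarith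
  \<comment> \<open>Real and complex arc cosine agree on the interval from -1 to 1, which links the
    points to the holomorphic function.\<close>
  have B: "of_real b = Arccos (cos (of_real s) - 1 / 2)"
    using of_real_arccos[of "cos s - 1 / 2"] \<open>cos s < 1\<close> \<open>cos s > 1 / 2\<close>
    by (simp add: b_def cos_of_real[symmetric])
  show "(\<Sum>x\<in>five_points t s. x ^ k) = power_sum_fun (k / t) (of_real s)"
  proof -
    have "(\<Sum>x\<in>five_points t s. x ^ k)
        = of_real (1 + 2 * cos (k / t * (pi + s)) + 2 * cos (k / t * b))"
      using five(2)[of k] assms unfolding five_points_def b_def Let_def by linarith
    also have "\<dots> = 1 + 2 * cos (of_real (k / t * (pi + s))) + 2 * cos (of_real (k / t * b))"
      by (simp only: cos_of_real) simp
    also have "\<dots> = power_sum_fun (k / t) (of_real s)"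
      by (simp only: power_sum_fun_def B of_real_mult of_real_add)
    finally show ?thesis .
  qed
qed

section \<open>Countably many bad parameters\<close>

text \<open>An open set is a countable union of compact sets. This provides the domain condition of
  \<open>holomorphic_countable_zeros\<close>.\<close>

lemma open_imp_fsigma:
  fixes S :: "'a::euclidean_space set"
  assumes "open S"
  shows "fsigma S"
proof -
  obtain C :: "nat \<Rightarrow> 'a set" where "\<And>n. compact (C n)" "\<Union> (range C) = S"
    using open_Union_compact_subsets[OF assms] by metis
  then show ?thesis
    using fsigma.intros[of C] by (auto simp: compact_imp_closed)
qed

text \<open>Continuity at 0, where \<open>cos z - 1 / 2\<close> is the centre of the disc. The bound
  \<open>r < pi\<close> keeps \<open>pi + s\<close> positive.\<close>

lemma obtain_parameter_ball:
  obtains r where "0 < r" "r < pi"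
    "\<And>z. z \<in> ball 0 r \<Longrightarrow> cos z - 1 / 2 \<in> ball (1 / 2 :: complex) (1 / 2)"
proof -
  have "isCont (\<lambda>z :: complex. cos z - 1 / 2) 0"
    by (intro continuous_intros)
  then obtain d where "d > 0" "\<And>z::complex. dist z 0 < d \<Longrightarrow> dist (cos z - 1 / 2) (1 / 2) < 1 / 2"
    unfolding continuous_at_eps_delta by (auto dest: spec[of _ "1 / 2"])
  then show ?thesis
    using pi_gt3 by (intro that[of "min d 3"]) (auto simp: dist_commute min_less_iff_disj)
qed

lemma holomorphic_power_sum_fun:
  assumes "\<And>z. z \<in> U \<Longrightarrow> cos z - 1 / 2 \<in> ball (1 / 2) (1 / 2)"
  shows "power_sum_fun \<kappa> holomorphic_on U"
  unfolding holomorphic_on_def field_differentiable_def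
  using has_field_derivative_power_sum_fun[OF assms] has_field_derivative_at_within by blast

lemma Hst_five_points:
  assumes "t \<ge> 1" "- pi < s" "s < 0" "cos s > 1 / 2"
    and "\<And>k :: nat. k \<ge> 1 \<Longrightarrow> k \<noteq> t \<Longrightarrow> power_sum_fun (k / t) (of_real s) \<noteq> 0"
  shows "Hst (five_points t s) = {t}"
proof -
  \<comment> \<open>For \<open>\<kappa> = 1\<close> the value is
    \<open>1 - 2 * cos s + 2 * (cos s - 1 / 2)\<close>.\<close>
  have "power_sum_fun 1 (of_real s) = 0"
    by (simp add: power_sum_fun_def cos_add)
  then show ?thesis
    using assms five_points(2)[OF assms(1-4)] unfolding Hst_complex by auto
qed

theorem theoremA:
  fixes t :: nat
  assumes "t \<ge> 1"
  shows "uncountable {X :: complex set. X \<subseteq> sphere 0 1 \<and> card X = 5 \<and> 1 \<in> X \<and> Hst X = {t}}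
    \<and> \<not> (\<exists>X :: complex set. finite X \<and> X \<noteq> {} \<and> X \<subseteq> sphere 0 1 \<and> card X < 5 \<and> Hst X = {t})"
    (is "uncountable ?F \<and> _")
proof
  obtain r where r: "0 < r" "r < pi"
    and r_ball: "\<And>z. z \<in> ball 0 r \<Longrightarrow> cos z - 1 / 2 \<in> ball (1 / 2 :: complex) (1 / 2)"
    by (rule obtain_parameter_ball) (rule that)
  \<comment> \<open>The complex parameters at which some power sum with \<open>k \<noteq> t\<close>
    vanishes: a countable union of zero sets of nonconstant holomorphic functions.\<close>
  define Z where "Z = (\<Union>k\<in>{1::nat..} - {t}. {z \<in> ball 0 r. power_sum_fun (k / t) z = 0})"
  have "countable Z"
    unfolding Z_def
  proof (intro countable_UN countable_Diff)
    fix k :: nat assume "k \<in> {1..} - {t}"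
    then have "\<not> power_sum_fun (k / t) constant_on ball 0 r"
      using assms r r_ball by (intro power_sum_fun_not_constant) auto
    then show "countable {z \<in> ball 0 r. power_sum_fun (k / t) z = 0}"
      using r_ball by (intro holomorphic_countable_zeros holomorphic_power_sum_fun open_imp_fsigma) auto
  qed auto
  define S where "S = {- r<..<0} - Re ` Z"
  have "uncountable S"
    unfolding S_def using r \<open>countable Z\<close>
    by (intro uncountable_minus_countable) (auto simp: uncountable_open_interval)
  have S: "five_points t s \<in> ?F" if "s \<in> S" for s
  proof -
    have s: "- r < s" "s < 0" "of_real s \<notin> Z"
      using that by (force simp: S_def)+
    have in_ball: "complex_of_real s \<in> ball 0 r"
      using s by simp
    have "cos s > 1 / 2"
      using r_ball[OF in_ball] abs_Re_le_cmod[of "1 - of_real (cos s)"]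
      by (simp add: dist_norm cos_of_real)
    then have 1: "t \<ge> 1" "- pi < s" "s < 0" "cos s > 1 / 2"
      using assms s r by auto
    have "Hst (five_points t s) = {t}"
      using s in_ball by (intro Hst_five_points[OF 1]) (auto simp: Z_def)
    moreover have "1 \<in> five_points t s" "five_points t s \<subseteq> sphere 0 1"
      by (auto simp: five_points_def Let_def)
    ultimately show ?thesis
      using five_points(1)[OF 1] by simp
  qed
  \<comment> \<open>Instead of injectivity of \<open>five_points t\<close>, the union of the family
    is used: a countable family of finite sets has a countable union, yet this one contains the
    distinct points \<open>cis ((pi + s) / t)\<close> for all \<open>s\<close> in
    \<open>S\<close>.\<close>
  show "uncountable ?F"
  proof
    assume "countable ?F"
    moreover have "countable X" if "X \<in> ?F" for X
      using that card.infinite[of X] by (intro countable_finite) force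
    ultimately have "countable (\<Union> ?F)"
      using countable_UN[of ?F "\<lambda>X. X"] by simp
    moreover have "(\<lambda>s. cis ((pi + s) / t)) ` S \<subseteq> \<Union> ?F"
    proof -
      have "cis ((pi + s) / t) \<in> five_points t s" for s
        by (simp add: five_points_def Let_def)
      with S show ?thesis by blast
    qed
    ultimately have "countable ((\<lambda>s. cis ((pi + s) / t)) ` S)"
      by (rule countable_subset[rotated])
    moreover have "inj_on (\<lambda>s. cis ((pi + s) / t)) S"
    proof -
      have "Arg (cis ((pi + s) / t)) = (pi + s) / t" if "s \<in> S" for s
      proof (rule cis_Arg_unique)
        have "0 < pi + s" "pi + s < pi" using that r by (auto simp: S_def)
        moreover from this have "0 < (pi + s) / t" "(pi + s) / t \<le> pi + s"
          using assms by (simp_all add: divide_le_eq mult_le_cancel_left1)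
        ultimately show "- pi < (pi + s) / t" "(pi + s) / t \<le> pi"
          by linarith+
      qed (simp add: sgn_eq)
      then show ?thesis
        using assms by (intro inj_onI) (metis add_left_cancel divide_cancel_right of_nat_0_eq_iff not_one_le_zero)
    qed
    ultimately show False
      using \<open>uncountable S\<close> by (simp add: countable_image_inj_eq)
  qed
next
  show "\<not> (\<exists>X :: complex set. finite X \<and> X \<noteq> {} \<and> X \<subseteq> sphere 0 1 \<and> card X < 5 \<and> Hst X = {t})"
  proof
    assume "\<exists>X :: complex set. finite X \<and> X \<noteq> {} \<and> X \<subseteq> sphere 0 1 \<and> card X < 5 \<and> Hst X = {t}"
    then obtain X :: "complex set" where X: "finite X" "X \<noteq> {}" "X \<subseteq> sphere 0 1" "card X < 5"
      and Hst: "Hst X = {t}" by blast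
    have "t \<in> Hst X" "2 * t \<notin> Hst X" "3 * t \<notin> Hst X"
      using Hst assms by simp_all
    then have "(\<Sum>x\<in>X. x ^ t) = 0" "(\<Sum>x\<in>X. x ^ (2 * t)) \<noteq> 0" "(\<Sum>x\<in>X. x ^ (3 * t)) \<noteq> 0"
      using assms unfolding Hst_complex by simp_all
    then show False
      using power_sum_eq_0_of_card_less_5[OF X] by blast
  qed
qed

end
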